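(* Let $m,n\ge 1$ and $1\le s\le m$ be integers, let $\{1,\dots,n\}$ be partitioned into two disjoint (possibly empty) sets $P_+$ and $P_n$, and let $\|\cdot\|$ be a norm on $\mathbb{R}^m$. For $\theta\ge 1$ put $\psi_\theta(t)=\max[-t,\theta t]$, $t\in\mathbb{R}$. The following six conditions on a real $m\times n$ matrix $A$ are equivalent to each other: (i) $A$ is $s$-semigood. (ii) For every subset $J\subset\{1,\dots,n\}$ with $\mathrm{Card}(J)\le s$ and every $x\in\mathrm{Ker}\,A\setminus\{0\}$ such that $x_i\le 0$ for all $i\in P_+\setminus J$, one has $$\sum_{i\in J\cap P_+}x_i+\sum_{i\in J\cap P_n}|x_i|<\sum_{i\notin J}|x_i|.$$ (iii) There exists $\xi\in(0,1)$ such that for every subset $J\subset\{1,\dots,n\}$ with $\mathrm{Card}(J)\le s$ and every $x\in\mathrm{Ker}\,A$ such that $x_i\le 0$ for all $i\in P_+\setminus J$, one has $$\sum_{i\in J\cap P_+}x_i+\sum_{i\in J\cap P_n}|x_i|\le\xi\sum_{i\notin J}|x_i|.$$ (iv) There exist $\xi\in(0,1)$ and $\theta\in[1,\infty)$ such that for every $x\in\mathrm{Ker}\,A$ and every subset $J\subset\{1,\dots,n\}$ with $\mathrm{Card}(J)\le s$, one has $$\sum_{i\in J\cap P_+}x_i+\sum_{i\in J\cap P_n}|x_i|\le\xi\Big(\sum_{i\in P_n\setminus J}|x_i|+\sum_{i\in P_+\setminus J}\psi_\theta(x_i)\Big),$$ or, equivalently (for the same $\xi,\theta$), for all $x\in\mathrm{Ker}\,A$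 one has $\Theta(x)\le\xi\Psi(x)$, where $$\Theta(x)=\max_{J\subset\{1,\dots,n\},\,\mathrm{Card}(J)\le s}\Big[\sum_{i\in J\cap P_+}\max[(1-\xi)x_i,(1+\theta\xi)x_i]+\sum_{i\in J\cap P_n}(1+\xi)|x_i|\Big],$$ $$\Psi(x)=\sum_{i\in P_+}\max[-x_i,\theta x_i]+\sum_{i\in P_n}|x_i|.$$ (v) There exist $\xi\in(0,1)$, $\theta\in[1,\infty)$ and $\beta\in[0,\infty)$ such that for every $x\in\mathbb{R}^n$ and every subset $J\subset\{1,\dots,n\}$ with $\mathrm{Card}(J)\le s$, one has $$\sum_{i\in J\cap P_+}x_i+\sum_{i\in J\cap P_n}|x_i|\le\beta\|Ax\|+\xi\Big(\sum_{i\in P_n\setminus J}|x_i|+\sum_{i\in P_+\setminus J}\psi_\theta(x_i)\Big).$$ (vi) There exist $\xi\in(0,1)$ and $\beta\in[0,\infty)$ such that for every subset $J\subset\{1,\dots,n\}$ with $\mathrm{Card}(J)\le s$ and every $x\in\mathbb{R}^n$ such that $x_i\le 0$ for all $i\in P_+\setminus J$, one has $$\sum_{i\in J\cap P_+}x_i+\sum_{i\in J\cap P_n}|x_i|\le\beta\|Ax\|+\xi\sum_{i\notin J}|x_i|.$$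
   Context: Definition. With $P_+,P_n$ and $s$ as in the claim, a real $m\times n$ matrix $A$ is called $s$-semigood if for every vector $w\in\mathbb{R}^n$ with at most $s$ nonzero entries and $w_i\ge 0$ for all $i\in P_+$, $w$ is the unique optimal solution to the problem $$\min_{z\in\mathbb{R}^n}\{\|z\|_1:\ Az=Aw,\ z_i\ge 0\ \ \forall i\in P_+\}.$$ $\mathrm{Card}(J)$ is the number of elements of $J$, and $i\notin J$ in sums means $i\in\{1,\dots,n\}\setminus J$. *)

theory Defs
  imports "HOL-Analysis.Analysis"
begin

(* An arbitrary norm on a real vector space; the type class norm on real ^ 'm is
   specifically the Euclidean one. *)
definition is_norm :: "('v::real_vector \<Rightarrow> real) \<Rightarrow> bool" where
  "is_norm N \<longleftrightarrow>
     (\<forall>x. N x \<ge> 0) \<and>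
     (\<forall>x. N x = 0 \<longleftrightarrow> x = 0) \<and>
     (\<forall>c x. N (c *\<^sub>R x) = \<bar>c\<bar> * N x) \<and>
     (\<forall>x y. N (x + y) \<le> N x + N y)"

definition l1norm :: "real ^ 'n \<Rightarrow> real" where
  "l1norm z = (\<Sum>i\<in>UNIV. \<bar>z $ i\<bar>)"

definition Ker :: "real ^ 'n ^ 'm \<Rightarrow> (real ^ 'n) set" where
  "Ker A = {x. A *v x = 0}"

definition semigood :: "nat \<Rightarrow> 'n set \<Rightarrow> real ^ 'n ^ 'm \<Rightarrow> bool" where
  "semigood s Pp A \<longleftrightarrow>
     (\<forall>w :: real ^ 'n.
        card {i. w $ i \<noteq> 0} \<le> s \<and> (\<forall>i\<in>Pp. w $ i \<ge> 0) \<longrightarrow>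
        (\<forall>z. is_arg_min l1norm (\<lambda>z. A *v z = A *v w \<and> (\<forall>i\<in>Pp. z $ i \<ge> 0)) z \<longleftrightarrow> z = w))"

definition psi :: "real \<Rightarrow> real \<Rightarrow> real" where
  "psi \<theta> t = max (- t) (\<theta> * t)"

definition head :: "'n set \<Rightarrow> 'n set \<Rightarrow> 'n set \<Rightarrow> real ^ 'n \<Rightarrow> real" where
  "head Pp Pn J x = (\<Sum>i\<in>J \<inter> Pp. x $ i) + (\<Sum>i\<in>J \<inter> Pn. \<bar>x $ i\<bar>)"

definition psi_tail :: "real \<Rightarrow> 'n set \<Rightarrow> 'n set \<Rightarrow> 'n set \<Rightarrow> real ^ 'n \<Rightarrow> real" where
  "psi_tail \<theta> Pp Pn J x = (\<Sum>i\<in>Pn - J. \<bar>x $ i\<bar>) + (\<Sum>i\<in>Pp - J. psi \<theta> (x $ i))"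

definition Theta :: "nat \<Rightarrow> real \<Rightarrow> real \<Rightarrow> 'n set \<Rightarrow> 'n set \<Rightarrow> real ^ 'n \<Rightarrow> real" where
  "Theta s \<xi> \<theta> Pp Pn x =
     Max ((\<lambda>J. (\<Sum>i\<in>J \<inter> Pp. max ((1 - \<xi>) * x $ i) ((1 + \<theta> * \<xi>) * x $ i))
               + (\<Sum>i\<in>J \<inter> Pn. (1 + \<xi>) * \<bar>x $ i\<bar>)) ` {J. card J \<le> s})"

definition Psi :: "real \<Rightarrow> 'n set \<Rightarrow> 'n set \<Rightarrow> real ^ 'n \<Rightarrow> real" where
  "Psi \<theta> Pp Pn x = (\<Sum>i\<in>Pp. max (- (x $ i)) (\<theta> * x $ i)) + (\<Sum>i\<in>Pn. \<bar>x $ i\<bar>)"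

end

theory Submission
  imports Defs
begin

text \<open>
  The sum over \<open>- J\<close> of the \<open>\<bar>x $ i\<bar>\<close> is called the tail of \<open>x\<close>, and a vector lies in the cone of
  \<open>J\<close> if it is nonpositive on \<open>Pp - J\<close>. Two arguments carry the proof.

  Exchange. If \<open>w\<close> is feasible with support in \<open>J\<close> and \<open>z\<close> is a competitor, then \<open>x = w - z\<close> lies
  in the kernel and in the cone of \<open>J\<close>, and \<open>l1norm w - l1norm z\<close> is at most head minus tail of
  \<open>x\<close>. Conversely, every \<open>x\<close> in the kernel and the cone is such a difference for a pair \<open>w, z\<close>
  for which this is an equality. Hence semigoodness means that head is strictly smaller than tail
  (\<open>semigood_iff\<close>).

  Compactness. The intersection of kernel and cone is the zero set of the continuous nonnegative function
  \<open>h x = N (A *v x) + (\<Sum>i\<in>Pp - J. max (x $ i) 0)\<close>. On the l1 unit sphere, strict negativity of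
  head minus tail on this zero set yields a positive gap \<open>\<delta>\<close> and a penalty \<open>k\<close> with
  \<open>head - tail + \<delta> \<le> k * h\<close> on the whole sphere; homogeneity extends this to every \<open>x\<close>. The gap
  turns the coefficient of the tail into \<open>\<xi> = 1 - \<delta>\<close>, the first summand of \<open>h\<close> becomes the
  term with \<open>\<beta>\<close>, and the second is absorbed by \<open>psi \<theta>\<close> for large \<open>\<theta>\<close>
  (\<open>uniform_bound_of_strict\<close>).

  The resulting inequality on the whole space is the strongest of the conditions. Restricting it to
  the kernel removes \<open>\<beta>\<close>, and restricting it to the cones replaces \<open>psi_tail\<close> by the tail. The
  weakest consequence is the ratio bound \<open>head \<le> \<xi> * tail\<close> on the kernel and the cones, and
  \<open>strict_of_ratio_bound\<close> leads from it back to the strict inequality. The only delicate vectors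
  there are those with zero tail.
\<close>

section \<open>Coordinatewise forms of the sums\<close>

lemma sum_Int_partition:
  fixes Pp Pn J :: "'n::finite set" and f g :: "'n \<Rightarrow> real"
  assumes "Pp \<union> Pn = UNIV" and "Pp \<inter> Pn = {}"
  shows "(\<Sum>i\<in>J \<inter> Pp. f i) + (\<Sum>i\<in>J \<inter> Pn. g i) = (\<Sum>i\<in>J. if i \<in> Pp then f i else g i)"
proof -
  have "J \<inter> - Pp = J \<inter> Pn" using assms by blast
  then show ?thesis by (simp add: sum.If_cases)
qed

lemma head_eq_sum:
  fixes x :: "real ^ 'n"
  assumes "Pp \<union> Pn = UNIV" and "Pp \<inter> Pn = {}"
  shows "head Pp Pn J x = (\<Sum>i\<in>J. if i \<in> Pp then x $ i else \<bar>x $ i\<bar>)"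
  unfolding head_def by (rule sum_Int_partition[OF assms])

lemma psi_tail_eq_sum:
  fixes x :: "real ^ 'n"
  assumes "Pp \<union> Pn = UNIV" and "Pp \<inter> Pn = {}"
  shows "psi_tail \<theta> Pp Pn J x = (\<Sum>i\<in>- J. if i \<in> Pp then psi \<theta> (x $ i) else \<bar>x $ i\<bar>)"
proof -
  have "Pp - J = - J \<inter> Pp" "Pn - J = - J \<inter> Pn" by auto
  then show ?thesis
    unfolding psi_tail_def using sum_Int_partition[OF assms, of "\<lambda>i. psi \<theta> (x $ i)" "- J" "\<lambda>i. \<bar>x $ i\<bar>"]
    by simp
qed

lemma sum_add_sum_Compl:
  fixes f g :: "'n::finite \<Rightarrow> real"
  shows "(\<Sum>i\<in>J. f i) + (\<Sum>i\<in>- J. g i) = (\<Sum>i\<in>UNIV. if i \<in> J then f i else g i)"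
  by (simp add: sum.If_cases)

lemma head_minus_tail_eq_sum:
  fixes x :: "real ^ 'n"
  assumes "Pp \<union> Pn = UNIV" and "Pp \<inter> Pn = {}"
  shows "head Pp Pn J x - (\<Sum>i\<in>- J. \<bar>x $ i\<bar>) =
    (\<Sum>i\<in>UNIV. if i \<in> J then (if i \<in> Pp then x $ i else \<bar>x $ i\<bar>) else - \<bar>x $ i\<bar>)"
  using sum_add_sum_Compl[of "\<lambda>i. if i \<in> Pp then x $ i else \<bar>x $ i\<bar>" J "\<lambda>i. - \<bar>x $ i\<bar>"]
  by (simp add: head_eq_sum[OF assms] sum_negf)

text \<open>
  On the cone only the branch \<open>- t\<close> of \<open>psi \<theta> t\<close> is visible, so \<open>\<theta>\<close> disappears.
\<close>

lemma psi_tail_eq_l1_tail: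
  fixes x :: "real ^ 'n"
  assumes "Pp \<union> Pn = UNIV" and "Pp \<inter> Pn = {}" and "1 \<le> \<theta>" and "\<forall>i\<in>Pp - J. x $ i \<le> 0"
  shows "psi_tail \<theta> Pp Pn J x = (\<Sum>i\<in>- J. \<bar>x $ i\<bar>)"
proof -
  have "psi \<theta> t = \<bar>t\<bar>" if "t \<le> 0" for t
  proof -
    have "\<theta> * t \<le> 0" using that assms(3) by (simp add: mult_nonneg_nonpos)
    then show ?thesis using that unfolding psi_def by auto
  qed
  then show ?thesis
    unfolding psi_tail_eq_sum[OF assms(1,2)] using assms(4) by (intro sum.cong) auto
qed

section \<open>Semigoodness as a strict inequality on the kernel\<close>

text \<open>
  The exchange argument. Coordinatewise, \<open>\<bar>w $ i\<bar> - \<bar>z $ i\<bar>\<close> is bounded by the \<open>i\<close>-th term of head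
  minus tail at \<open>w - z\<close>: on \<open>Pp\<close> both entries are nonnegative, so the difference is exactly
  \<open>w $ i - z $ i\<close>; on \<open>Pn\<close> the triangle inequality applies; off \<open>J\<close> the entry of \<open>w\<close>
  vanishes.
\<close>

lemma semigood_iff:
  fixes A :: "real ^ 'n ^ 'm"
  assumes "Pp \<union> Pn = UNIV" and "Pp \<inter> Pn = {}"
  shows "semigood s Pp A \<longleftrightarrow>
     (\<forall>J x. card J \<le> s \<and> x \<in> Ker A - {0} \<and> (\<forall>i\<in>Pp - J. x $ i \<le> 0) \<longrightarrow>
        head Pp Pn J x < (\<Sum>i\<in>- J. \<bar>x $ i\<bar>))" (is "_ \<longleftrightarrow> ?strict")
proof
  assume good: "semigood s Pp A"
  show ?strict
  proof (intro allI impI, elim conjE)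
    fix J and x :: "real ^ 'n"
    assume J: "card J \<le> s" and x: "x \<in> Ker A - {0}" and sgn: "\<forall>i\<in>Pp - J. x $ i \<le> 0"
    \<comment> \<open>The choice of \<open>w\<close> makes the comparison tight: on \<open>J \<inter> Pp\<close> the vectors \<open>w\<close> and \<open>w - x\<close> are
      the positive and negative parts of \<open>x\<close>, and elsewhere one of the two is zero.\<close>
    define w :: "real ^ 'n" where
      "w = (\<chi> i. if i \<in> J then (if i \<in> Pp then max (x $ i) 0 else x $ i) else 0)"
    define F where "F = (\<lambda>z. A *v z = A *v w \<and> (\<forall>i\<in>Pp. z $ i \<ge> 0))"
    have "card {i. w $ i \<noteq> 0} \<le> card J"
      by (rule card_mono) (auto simp: w_def)
    then have uniq: "is_arg_min l1norm F z \<longleftrightarrow> z = w" for z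
      using good J unfolding semigood_def F_def by (auto simp: w_def)
    have "F (w - x)"
      using x sgn by (auto simp: F_def Ker_def matrix_vector_mult_diff_distrib w_def)
    moreover have "\<not> is_arg_min l1norm F (w - x)" using uniq x by simp
    moreover have "is_arg_min l1norm F w" using uniq by simp
    ultimately have "l1norm w < l1norm (w - x)"
      unfolding is_arg_min_def by (metis linorder_less_linear order.strict_trans)
    moreover have "l1norm w - l1norm (w - x) = head Pp Pn J x - (\<Sum>i\<in>- J. \<bar>x $ i\<bar>)"
      unfolding head_minus_tail_eq_sum[OF assms] l1norm_def sum_subtractf[symmetric]
      by (intro sum.cong) (auto simp: w_def)
    ultimately show "head Pp Pn J x < (\<Sum>i\<in>- J. \<bar>x $ i\<bar>)" by simp
  qed
next
  assume strict: ?strict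
  show "semigood s Pp A"
    unfolding semigood_def
  proof (rule allI, rule impI, elim conjE)
    fix w :: "real ^ 'n"
    assume w: "card {i. w $ i \<noteq> 0} \<le> s" "\<forall>i\<in>Pp. 0 \<le> w $ i"
    define F where "F = (\<lambda>z. A *v z = A *v w \<and> (\<forall>i\<in>Pp. z $ i \<ge> 0))"
    define J where "J = {i. w $ i \<noteq> 0}"
    have less: "l1norm w < l1norm z" if "F z" "z \<noteq> w" for z
    proof -
      have "w - z \<in> Ker A - {0}" "\<forall>i\<in>Pp - J. (w - z) $ i \<le> 0"
        using that by (auto simp: F_def Ker_def matrix_vector_mult_diff_distrib J_def)
      moreover have "card J \<le> s" using w(1) by (simp add: J_def)
      ultimately have "head Pp Pn J (w - z) < (\<Sum>i\<in>- J. \<bar>(w - z) $ i\<bar>)"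
        using strict by blast
      moreover have "l1norm w - l1norm z \<le> head Pp Pn J (w - z) - (\<Sum>i\<in>- J. \<bar>(w - z) $ i\<bar>)"
        unfolding head_minus_tail_eq_sum[OF assms] l1norm_def sum_subtractf[symmetric]
        using w(2) that(1) by (intro sum_mono) (auto simp: J_def F_def)
      ultimately show ?thesis by linarith
    qed
    have "F w" using w by (simp add: F_def)
    then have "is_arg_min l1norm F z \<longleftrightarrow> z = w" for z
      unfolding is_arg_min_def using less by (metis order.strict_trans less_irrefl)
    then show "\<forall>z. is_arg_min l1norm (\<lambda>z. A *v z = A *v w \<and> (\<forall>i\<in>Pp. z $ i \<ge> 0)) z \<longleftrightarrow> z = w"
      by (simp add: F_def)
  qed
qed

text \<open>
  If the tail of \<open>x\<close> is positive, \<open>\<xi> < 1\<close> makes the bound strict. If the tail vanishes, such an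
  \<open>x \<noteq> 0\<close> cannot exist: \<open>- x\<close> lies in the cone of \<open>J\<close> as well, and the two bounds
  \<open>head \<le> 0\<close> force \<open>x\<close> to vanish on \<open>Pn\<close> and its entries to sum to zero. With \<open>Q\<close> the set
  of positive entries in place of \<open>J\<close>, head and tail are then the same positive number, which
  contradicts the ratio bound.
\<close>

lemma strict_of_ratio_bound:
  fixes A :: "real ^ 'n ^ 'm"
  assumes part: "Pp \<union> Pn = UNIV" "Pp \<inter> Pn = {}" and "\<xi> < 1"
    and bound: "\<And>J x. card J \<le> s \<Longrightarrow> x \<in> Ker A \<Longrightarrow> \<forall>i\<in>Pp - J. x $ i \<le> 0 \<Longrightarrow>
      head Pp Pn J x \<le> \<xi> * (\<Sum>i\<in>- J. \<bar>x $ i\<bar>)"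
    and J: "card J \<le> s" and x: "x \<in> Ker A" "x \<noteq> 0" and sgn: "\<forall>i\<in>Pp - J. x $ i \<le> 0"
  shows "head Pp Pn J x < (\<Sum>i\<in>- J. \<bar>x $ i\<bar>)"
proof (cases "\<forall>i\<in>- J. x $ i = 0")
  case False
  then have "0 < (\<Sum>i\<in>- J. \<bar>x $ i\<bar>)" by (auto intro!: sum_pos2)
  then have "\<xi> * (\<Sum>i\<in>- J. \<bar>x $ i\<bar>) < (\<Sum>i\<in>- J. \<bar>x $ i\<bar>)" using \<open>\<xi> < 1\<close> by simp
  then show ?thesis using bound[OF J x(1) sgn] by simp
next
  case supp: True
  have neg: "- x \<in> Ker A" using x(1) matrix_vector_mult_diff_distrib[of A 0 x] by (simp add: Ker_def)
  have hx: "head Pp Pn J x \<le> 0" and hn: "head Pp Pn J (- x) \<le> 0"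
    using bound[OF J x(1) sgn] bound[OF J neg] supp by auto
  have "(\<Sum>i\<in>J \<inter> Pn. \<bar>x $ i\<bar>) \<le> 0" using hx hn by (simp add: head_def sum_negf)
  then have Pn_zero: "(\<Sum>i\<in>J \<inter> Pn. \<bar>x $ i\<bar>) = 0" by (simp add: order_antisym sum_nonneg)
  have off: "x $ i = 0" if "i \<notin> Pp" for i
  proof -
    have "\<forall>i\<in>J \<inter> Pn. x $ i = 0" using Pn_zero by (simp add: sum_nonneg_eq_0_iff)
    then show ?thesis using that supp part by blast
  qed
  have "(\<Sum>i\<in>J \<inter> Pp. x $ i) = 0" using hx hn Pn_zero by (simp add: head_def sum_negf)
  moreover have "(\<Sum>i\<in>UNIV. x $ i) = (\<Sum>i\<in>J \<inter> Pp. x $ i)"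
    using supp off by (intro sum.mono_neutral_right) auto
  ultimately have total: "(\<Sum>i\<in>UNIV. x $ i) = 0" by simp
  define Q where "Q = {i. x $ i > 0}"
  have "Q \<subseteq> J" using supp by (force simp: Q_def)
  then have "card Q \<le> s" using J card_mono[of J Q] by simp
  then have "head Pp Pn Q x \<le> \<xi> * (\<Sum>i\<in>- Q. \<bar>x $ i\<bar>)"
    using x(1) by (intro bound) (auto simp: Q_def)
  moreover have "head Pp Pn Q x = (\<Sum>i\<in>Q. x $ i)"
    unfolding head_eq_sum[OF part] by (intro sum.cong) (auto simp: Q_def)
  moreover have "(\<Sum>i\<in>- Q. \<bar>x $ i\<bar>) = (\<Sum>i\<in>Q. x $ i)"
  proof -
    have "(\<Sum>i\<in>- Q. \<bar>x $ i\<bar>) = - (\<Sum>i\<in>- Q. x $ i)"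
      unfolding sum_negf[symmetric] by (intro sum.cong) (auto simp: Q_def)
    moreover have "(\<Sum>i\<in>Q. x $ i) + (\<Sum>i\<in>- Q. x $ i) = (\<Sum>i\<in>UNIV. x $ i)"
      by (simp add: sum_add_sum_Compl)
    ultimately show ?thesis using total by simp
  qed
  ultimately have le: "(\<Sum>i\<in>Q. x $ i) \<le> \<xi> * (\<Sum>i\<in>Q. x $ i)" by simp
  have "Q \<noteq> {}"
  proof
    assume "Q = {}"
    then have "\<forall>i\<in>UNIV. x $ i = 0"
      using total sum_nonneg_eq_0_iff[of UNIV "\<lambda>i. - x $ i"]
      by (force simp: Q_def sum_negf not_less)
    then show False using x(2) by (simp add: vec_eq_iff)
  qed
  then have "0 < (\<Sum>i\<in>Q. x $ i)" by (intro sum_pos) (auto simp: Q_def)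
  then have "\<xi> * (\<Sum>i\<in>Q. x $ i) < (\<Sum>i\<in>Q. x $ i)" using \<open>\<xi> < 1\<close> by simp
  then show ?thesis using le by simp
qed

section \<open>Compactness\<close>

lemma is_norm_continuous_on:
  fixes N :: "'v::euclidean_space \<Rightarrow> real"
  assumes "is_norm N"
  shows "continuous_on S N"
proof -
  have "convex_on UNIV N"
  proof (rule convex_onI)
    fix t :: real and x y
    assume "0 < t" "t < 1"
    then show "N ((1 - t) *\<^sub>R x + t *\<^sub>R y) \<le> (1 - t) * N x + t * N y"
      using assms unfolding is_norm_def by (smt (verit, best))
  qed simp
  then have "continuous_on UNIV N" using convex_on_continuous open_UNIV by blast
  then show ?thesis using continuous_on_subset by blast
qed

text \<open>
  The exact penalty principle on a compact set. The strict inequality defines open sets which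
  increase with \<open>k\<close> within \<open>K\<close>, and they cover \<open>K\<close>: where \<open>h\<close> vanishes, \<open>g\<close> is negative
  and \<open>1 / Suc k\<close> becomes small enough; elsewhere \<open>k * h\<close> is unbounded. One parameter \<open>k\<close>
  governs both the gap and the penalty, so that the conclusion is an eventuality and several such
  statements can be satisfied simultaneously.
\<close>

lemma compact_eventually_penalty:
  fixes g h :: "'a::metric_space \<Rightarrow> real"
  assumes K: "compact K" and g: "continuous_on UNIV g" and h: "continuous_on UNIV h"
    and nonneg: "\<And>x. x \<in> K \<Longrightarrow> 0 \<le> h x"
    and neg: "\<And>x. x \<in> K \<Longrightarrow> h x = 0 \<Longrightarrow> g x < 0"
  shows "\<forall>\<^sub>F k in sequentially. \<forall>x\<in>K. g x + 1 / real (Suc k) \<le> real k * h x"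
proof -
  define U where "U k = {x. g x + 1 / real (Suc k) < real k * h x}" for k
  have open_U: "open (U k)" for k
    unfolding U_def by (intro open_Collect_less continuous_intros g h)
  have U_mono: "x \<in> U l" if "x \<in> U k" "k \<le> l" "x \<in> K" for x k l
  proof -
    have "1 / real (Suc l) \<le> 1 / real (Suc k)" using that(2) by (simp add: frac_le)
    moreover have "real k * h x \<le> real l * h x"
      using that(2) nonneg[OF that(3)] by (simp add: mult_right_mono)
    ultimately show ?thesis using that(1) unfolding U_def by simp
  qed
  have "K \<subseteq> (\<Union>k\<in>UNIV. U k)"
  proof
    fix x assume x: "x \<in> K"
    show "x \<in> (\<Union>k\<in>UNIV. U k)"
    proof (cases "h x = 0")
      case True
      then have "0 < - g x" using neg[OF x] by simp
      then obtain k where "inverse (real (Suc k)) < - g x" by (rule reals_Archimedean[THEN exE])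
      then show ?thesis using True by (auto simp: U_def inverse_eq_divide intro!: exI[of _ k])
    next
      case False
      then have "0 < h x" using nonneg[OF x] by simp
      then obtain k where "g x + 1 < real k * h x" using reals_Archimedean3 by blast
      moreover have "1 / real (Suc k) \<le> 1" by simp
      ultimately have "x \<in> U k" unfolding U_def mem_Collect_eq by linarith
      then show ?thesis by blast
    qed
  qed
  then obtain C where C: "finite C" "K \<subseteq> (\<Union>k\<in>C. U k)"
    using compactE_image[OF K, of UNIV U] open_U by metis
  have "\<forall>x\<in>K. g x + 1 / real (Suc l) \<le> real l * h x" if "\<forall>k\<in>C. k \<le> l" for l
    using C(2) U_mono that unfolding U_def by (force simp del: of_nat_Suc)
  moreover have "\<forall>\<^sub>F l in sequentially. \<forall>k\<in>C. k \<le> l"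
    using C(1) by (intro eventually_ball_finite) (auto intro: eventually_ge_at_top)
  ultimately show ?thesis by (rule eventually_mono[rotated])
qed

lemma continuous_on_l1norm: "continuous_on S l1norm"
  unfolding l1norm_def by (intro continuous_intros)

lemma compact_l1_sphere: "compact {x :: real ^ 'n. l1norm x = 1}"
proof -
  have "closed {x :: real ^ 'n. l1norm x = 1}"
    by (intro closed_Collect_eq continuous_on_l1norm continuous_on_const)
  moreover have "bounded {x :: real ^ 'n. l1norm x = 1}"
    unfolding bounded_iff l1norm_def using norm_le_l1_cart by (metis mem_Collect_eq)
  ultimately show ?thesis by (simp add: compact_eq_bounded_closed)
qed

text \<open>
  The penalty bracket vanishes exactly on the kernel intersected with the cone of \<open>J\<close>. Both sides
  are positively homogeneous, so compactness of the l1 unit sphere gives the bound everywhere.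
\<close>

lemma eventually_penalized_bound:
  fixes A :: "real ^ 'n ^ 'm"
  assumes N: "is_norm N"
    and strict: "\<And>x. x \<in> Ker A \<Longrightarrow> x \<noteq> 0 \<Longrightarrow> \<forall>i\<in>Pp - J. x $ i \<le> 0 \<Longrightarrow>
      head Pp Pn J x < (\<Sum>i\<in>- J. \<bar>x $ i\<bar>)"
  shows "\<forall>\<^sub>F k in sequentially. \<forall>x.
    head Pp Pn J x - (\<Sum>i\<in>- J. \<bar>x $ i\<bar>) + l1norm x / real (Suc k)
      \<le> real k * (N (A *v x) + (\<Sum>i\<in>Pp - J. max (x $ i) 0))"
proof -
  define g where "g x = head Pp Pn J x - (\<Sum>i\<in>- J. \<bar>x $ i\<bar>)" for x
  define h where "h x = N (A *v x) + (\<Sum>i\<in>Pp - J. max (x $ i) 0)" for x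
  have N0: "0 \<le> N y" and N_zero: "N y = 0 \<longleftrightarrow> y = 0" and N_scale: "N (c *\<^sub>R y) = \<bar>c\<bar> * N y" for y c
    using N by (auto simp: is_norm_def)
  have h_zero: "x \<in> Ker A \<and> (\<forall>i\<in>Pp - J. x $ i \<le> 0)" if "h x = 0" for x
  proof -
    have "0 \<le> (\<Sum>i\<in>Pp - J. max (x $ i) 0)" by (simp add: sum_nonneg)
    then have "N (A *v x) = 0" "(\<Sum>i\<in>Pp - J. max (x $ i) 0) = 0"
      using that N0[of "A *v x"] unfolding h_def by linarith+
    then show ?thesis
      by (auto simp: N_zero Ker_def sum_nonneg_eq_0_iff max_def split: if_splits)
  qed
  have "\<forall>\<^sub>F k in sequentially. \<forall>x\<in>{x. l1norm x = 1}. g x + 1 / real (Suc k) \<le> real k * h x"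
  proof (rule compact_eventually_penalty[OF compact_l1_sphere])
    show "continuous_on UNIV g" unfolding g_def head_def by (intro continuous_intros)
    show "continuous_on UNIV h"
      unfolding h_def
      by (intro continuous_intros continuous_on_compose2[OF is_norm_continuous_on[OF N, of UNIV]]
          matrix_vector_mult_linear_continuous_on) auto
    show "0 \<le> h x" for x unfolding h_def by (simp add: N0 sum_nonneg)
    show "g x < 0" if "x \<in> {x. l1norm x = 1}" "h x = 0" for x
    proof -
      have "x \<noteq> 0" using that(1) by (auto simp: l1norm_def)
      then show ?thesis using h_zero[OF that(2)] strict[of x] by (simp add: g_def)
    qed
  qed
  then show ?thesis
  proof (rule eventually_mono, intro allI)
    fix k and x :: "real ^ 'n"
    assume sphere: "\<forall>x\<in>{x. l1norm x = 1}. g x + 1 / real (Suc k) \<le> real k * h x"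
    have "g x + l1norm x / real (Suc k) \<le> real k * h x"
    proof (cases "x = 0")
      case True
      then show ?thesis using N0[of 0] by (simp add: g_def h_def head_def l1norm_def)
    next
      case False
      define c where "c = l1norm x"
      have "0 < c"
        using False norm_le_l1_cart[of x] unfolding c_def l1norm_def
        by (smt (verit) zero_less_norm_iff)
      define y where "y = (1 / c) *\<^sub>R x"
      have x_eq: "x = c *\<^sub>R y" using \<open>0 < c\<close> by (simp add: y_def)
      have "l1norm y = 1"
        using \<open>0 < c\<close> by (simp add: y_def c_def l1norm_def abs_mult flip: sum_divide_distrib)
      then have "c * (g y + 1 / real (Suc k)) \<le> c * (real k * h y)"
        using sphere \<open>0 < c\<close> by (simp add: mult_left_mono del: of_nat_Suc)
      moreover have "g x = c * g y"
        using \<open>0 < c\<close> unfolding x_eq g_def head_def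
        by (simp add: abs_mult sum_distrib_left algebra_simps)
      moreover have "h x = c * h y"
      proof -
        have "max (c * t) 0 = c * max t 0" for t
          using \<open>0 < c\<close> by (auto simp: max_def zero_le_mult_iff mult_le_0_iff)
        then show ?thesis
          using \<open>0 < c\<close> unfolding x_eq h_def
          by (simp add: matrix_vector_mult_scaleR N_scale sum_distrib_left distrib_left)
      qed
      ultimately show ?thesis by (simp add: c_def distrib_left mult.left_commute del: of_nat_Suc)
    qed
    then show "head Pp Pn J x - (\<Sum>i\<in>- J. \<bar>x $ i\<bar>) + l1norm x / real (Suc k)
      \<le> real k * (N (A *v x) + (\<Sum>i\<in>Pp - J. max (x $ i) 0))"
      by (simp add: g_def h_def)
  qed
qed

text \<open>
  Since the tail is at most \<open>l1norm x\<close>, the gap \<open>l1norm x / Suc k\<close> pays for lowering the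
  coefficient of the tail from 1 to \<open>\<xi> = 1 - 1 / Suc k\<close>. There are only finitely many \<open>J\<close>, so one
  \<open>k\<close> serves them all.
\<close>

lemma uniform_bound_of_strict:
  fixes A :: "real ^ 'n ^ 'm"
  assumes part: "Pp \<union> Pn = UNIV" "Pp \<inter> Pn = {}" and N: "is_norm N"
    and strict: "\<And>J x. card J \<le> s \<Longrightarrow> x \<in> Ker A \<Longrightarrow> x \<noteq> 0 \<Longrightarrow> \<forall>i\<in>Pp - J. x $ i \<le> 0 \<Longrightarrow>
      head Pp Pn J x < (\<Sum>i\<in>- J. \<bar>x $ i\<bar>)"
  shows "\<exists>\<xi> \<theta> \<beta>. 0 < \<xi> \<and> \<xi> < 1 \<and> 1 \<le> \<theta> \<and> 0 \<le> \<beta> \<and>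
    (\<forall>x J. card J \<le> s \<longrightarrow>
       head Pp Pn J x \<le> \<beta> * N (A *v x) + \<xi> * psi_tail \<theta> Pp Pn J x)"
proof -
  have "\<forall>\<^sub>F k in sequentially. \<forall>J\<in>{J. card J \<le> s}. \<forall>x.
    head Pp Pn J x - (\<Sum>i\<in>- J. \<bar>x $ i\<bar>) + l1norm x / real (Suc k)
      \<le> real k * (N (A *v x) + (\<Sum>i\<in>Pp - J. max (x $ i) 0))"
    by (intro eventually_ball_finite ballI eventually_penalized_bound N strict) auto
  \<comment> \<open>For \<open>k = 0\<close> the coefficient \<open>\<xi>\<close> chosen below would be zero.\<close>
  then have "\<forall>\<^sub>F k in sequentially. 1 \<le> k \<and> (\<forall>J\<in>{J. card J \<le> s}. \<forall>x.
    head Pp Pn J x - (\<Sum>i\<in>- J. \<bar>x $ i\<bar>) + l1norm x / real (Suc k)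
      \<le> real k * (N (A *v x) + (\<Sum>i\<in>Pp - J. max (x $ i) 0)))"
    using eventually_ge_at_top[of 1] by (rule eventually_conj[rotated])
  then obtain k where k: "1 \<le> k" and pen: "\<And>J x. card J \<le> s \<Longrightarrow>
    head Pp Pn J x - (\<Sum>i\<in>- J. \<bar>x $ i\<bar>) + l1norm x / real (Suc k)
      \<le> real k * (N (A *v x) + (\<Sum>i\<in>Pp - J. max (x $ i) 0))"
    using eventually_happens'[OF sequentially_bot] by blast
  define \<xi> where "\<xi> = 1 - 1 / real (Suc k)"
  \<comment> \<open>This is the value for which \<open>\<xi> * \<theta> = \<xi> + k\<close>: at positive entries \<open>\<xi> * psi \<theta>\<close> then
    covers both the tail and the penalty for leaving the cone.\<close>
  define \<theta> where "\<theta> = 1 + real k / \<xi>"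
  have \<xi>: "0 < \<xi>" "\<xi> < 1" using k by (auto simp: \<xi>_def field_simps)
  have \<theta>: "1 \<le> \<theta>" using \<xi> by (simp add: \<theta>_def)
  have point: "\<xi> * \<bar>t\<bar> + real k * max t 0 \<le> \<xi> * psi \<theta> t" for t
  proof (cases "0 \<le> t")
    case True
    have "\<xi> * \<bar>t\<bar> + real k * max t 0 = \<xi> * (\<theta> * t)"
      using True \<xi> by (simp add: \<theta>_def field_simps)
    also have "\<dots> \<le> \<xi> * psi \<theta> t" using \<xi> by (simp add: psi_def)
    finally show ?thesis .
  next
    case False
    then have "max t 0 = 0" "\<bar>t\<bar> \<le> psi \<theta> t" by (auto simp: psi_def)
    then show ?thesis using mult_left_mono[of "\<bar>t\<bar>" "psi \<theta> t" \<xi>] \<xi> by simp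
  qed
  have "head Pp Pn J x \<le> real k * N (A *v x) + \<xi> * psi_tail \<theta> Pp Pn J x"
    if J: "card J \<le> s" for J x
  proof -
    have "(\<Sum>i\<in>- J. \<bar>x $ i\<bar>) \<le> l1norm x"
      unfolding l1norm_def by (intro sum_mono2) auto
    then have "(\<Sum>i\<in>- J. \<bar>x $ i\<bar>) / real (Suc k) \<le> l1norm x / real (Suc k)"
      by (simp add: divide_right_mono del: of_nat_Suc)
    then have "head Pp Pn J x \<le> real k * N (A *v x) +
        (\<xi> * (\<Sum>i\<in>- J. \<bar>x $ i\<bar>) + real k * (\<Sum>i\<in>Pp - J. max (x $ i) 0))"
      using pen[OF J, of x] by (simp add: \<xi>_def algebra_simps del: of_nat_Suc)
    also have "\<xi> * (\<Sum>i\<in>- J. \<bar>x $ i\<bar>) + real k * (\<Sum>i\<in>Pp - J. max (x $ i) 0) =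
        (\<Sum>i\<in>- J. \<xi> * \<bar>x $ i\<bar> + (if i \<in> Pp then real k * max (x $ i) 0 else 0))"
    proof -
      have "- J \<inter> Pp = Pp - J" by auto
      then show ?thesis by (simp add: sum.distrib sum_distrib_left sum.If_cases)
    qed
    also have "\<dots> \<le> (\<Sum>i\<in>- J. \<xi> * (if i \<in> Pp then psi \<theta> (x $ i) else \<bar>x $ i\<bar>))"
      using point by (intro sum_mono) auto
    also have "\<dots> = \<xi> * psi_tail \<theta> Pp Pn J x"
      by (simp add: psi_tail_eq_sum[OF part] sum_distrib_left)
    finally show ?thesis by simp
  qed
  then show ?thesis using \<xi> \<theta> of_nat_0_le_iff by blast
qed

section \<open>The maximum form of the inequality with psi\<close>

lemma Psi_eq_psi_tail_add:
  fixes x :: "real ^ 'n"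
  assumes "Pp \<union> Pn = UNIV" and "Pp \<inter> Pn = {}"
  shows "Psi \<theta> Pp Pn x =
    psi_tail \<theta> Pp Pn J x + (\<Sum>i\<in>J. if i \<in> Pp then psi \<theta> (x $ i) else \<bar>x $ i\<bar>)"
proof -
  have "Psi \<theta> Pp Pn x = (\<Sum>i\<in>UNIV. if i \<in> Pp then psi \<theta> (x $ i) else \<bar>x $ i\<bar>)"
    using sum_Int_partition[OF assms, of "\<lambda>i. psi \<theta> (x $ i)" UNIV "\<lambda>i. \<bar>x $ i\<bar>"]
    by (simp add: Psi_def psi_def)
  also have "\<dots> = (\<Sum>i\<in>J. if i \<in> Pp then psi \<theta> (x $ i) else \<bar>x $ i\<bar>)
      + (\<Sum>i\<in>- J. if i \<in> Pp then psi \<theta> (x $ i) else \<bar>x $ i\<bar>)"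
    unfolding sum_add_sum_Compl by simp
  finally show ?thesis by (simp add: psi_tail_eq_sum[OF assms])
qed

text \<open>
  The equivalence holds for each \<open>J\<close> separately: adding to both sides of the inequality \<open>\<xi>\<close> times
  the \<open>J\<close>-part of \<open>Psi\<close> completes \<open>psi_tail\<close> to \<open>Psi\<close> on the right and produces the expression
  maximized in \<open>Theta\<close> on the left, because \<open>t + \<xi> * psi \<theta> t\<close> is the maximum of
  \<open>(1 - \<xi>) * t\<close> and \<open>(1 + \<theta> * \<xi>) * t\<close>.
\<close>

lemma head_le_iff_Theta_le:
  fixes x :: "real ^ 'n"
  assumes part: "Pp \<union> Pn = UNIV" "Pp \<inter> Pn = {}" and "0 < \<xi>"
  shows "(\<forall>J. card J \<le> s \<longrightarrow> head Pp Pn J x \<le> \<xi> * psi_tail \<theta> Pp Pn J x) \<longleftrightarrow>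
    Theta s \<xi> \<theta> Pp Pn x \<le> \<xi> * Psi \<theta> Pp Pn x"
proof -
  define T where "T J = (\<Sum>i\<in>J \<inter> Pp. max ((1 - \<xi>) * x $ i) ((1 + \<theta> * \<xi>) * x $ i))
    + (\<Sum>i\<in>J \<inter> Pn. (1 + \<xi>) * \<bar>x $ i\<bar>)" for J
  have coord: "max ((1 - \<xi>) * t) ((1 + \<theta> * \<xi>) * t) = t + \<xi> * psi \<theta> t" for t
  proof -
    have "\<xi> * psi \<theta> t = max (\<xi> * - t) (\<xi> * (\<theta> * t))"
      using \<open>0 < \<xi>\<close> by (simp add: psi_def max_mult_distrib_left)
    then show ?thesis by (simp add: max_add_distrib_right algebra_simps)
  qed
  have T: "T J = head Pp Pn J x + \<xi> * (Psi \<theta> Pp Pn x - psi_tail \<theta> Pp Pn J x)" for J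
  proof -
    have "T J = (\<Sum>i\<in>J. (if i \<in> Pp then x $ i else \<bar>x $ i\<bar>)
        + \<xi> * (if i \<in> Pp then psi \<theta> (x $ i) else \<bar>x $ i\<bar>))"
      unfolding T_def coord sum_Int_partition[OF part]
      by (intro sum.cong) (auto simp: algebra_simps)
    then show ?thesis
      by (simp add: Psi_eq_psi_tail_add[OF part, of _ _ J] head_eq_sum[OF part]
          sum.distrib sum_distrib_left)
  qed
  have "Theta s \<xi> \<theta> Pp Pn x = Max (T ` {J. card J \<le> s})"
    by (simp add: Theta_def T_def)
  moreover have "{J :: 'n set. card J \<le> s} \<noteq> {}" by (auto intro: exI[of _ "{}"])
  ultimately show ?thesis by (auto simp: T algebra_simps)
qed

section \<open>The equivalence\<close>

(* (i) iff each of (ii)-(vi); the fourth conjunct says that the two forms of (iv)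
   are equivalent for the same xi and theta. *)
theorem proposition2p1:
  fixes A :: "real ^ 'n ^ 'm"
    and s :: nat
    and Pp Pn :: "'n set"
    and N :: "real ^ 'm \<Rightarrow> real"
  assumes "1 \<le> s" and "s \<le> CARD('m)"
    and "Pp \<union> Pn = UNIV" and "Pp \<inter> Pn = {}"
    and "is_norm N"
  shows
    "(semigood s Pp A \<longleftrightarrow>
       (\<forall>J x. card J \<le> s \<and> x \<in> Ker A - {0} \<and> (\<forall>i\<in>Pp - J. x $ i \<le> 0) \<longrightarrow>
          head Pp Pn J x < (\<Sum>i\<in>- J. \<bar>x $ i\<bar>))) \<and>
     (semigood s Pp A \<longleftrightarrow>
       (\<exists>\<xi>. 0 < \<xi> \<and> \<xi> < 1 \<and>
          (\<forall>J x. card J \<le> s \<and> x \<in> Ker A \<and> (\<forall>i\<in>Pp - J. x $ i \<le> 0) \<longrightarrow>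
             head Pp Pn J x \<le> \<xi> * (\<Sum>i\<in>- J. \<bar>x $ i\<bar>)))) \<and>
     (semigood s Pp A \<longleftrightarrow>
       (\<exists>\<xi> \<theta>. 0 < \<xi> \<and> \<xi> < 1 \<and> 1 \<le> \<theta> \<and>
          (\<forall>x J. x \<in> Ker A \<and> card J \<le> s \<longrightarrow>
             head Pp Pn J x \<le> \<xi> * psi_tail \<theta> Pp Pn J x))) \<and>
     (\<forall>\<xi> \<theta>. 0 < \<xi> \<and> \<xi> < 1 \<and> 1 \<le> \<theta> \<longrightarrow>
       ((\<forall>x J. x \<in> Ker A \<and> card J \<le> s \<longrightarrow>
           head Pp Pn J x \<le> \<xi> * psi_tail \<theta> Pp Pn J x) \<longleftrightarrow>
        (\<forall>x\<in>Ker A. Theta s \<xi> \<theta> Pp Pn x \<le> \<xi> * Psi \<theta> Pp Pn x))) \<and>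
     (semigood s Pp A \<longleftrightarrow>
       (\<exists>\<xi> \<theta> \<beta>. 0 < \<xi> \<and> \<xi> < 1 \<and> 1 \<le> \<theta> \<and> 0 \<le> \<beta> \<and>
          (\<forall>x J. card J \<le> s \<longrightarrow>
             head Pp Pn J x \<le> \<beta> * N (A *v x) + \<xi> * psi_tail \<theta> Pp Pn J x))) \<and>
     (semigood s Pp A \<longleftrightarrow>
       (\<exists>\<xi> \<beta>. 0 < \<xi> \<and> \<xi> < 1 \<and> 0 \<le> \<beta> \<and>
          (\<forall>J x. card J \<le> s \<and> (\<forall>i\<in>Pp - J. x $ i \<le> 0) \<longrightarrow>
             head Pp Pn J x \<le> \<beta> * N (A *v x) + \<xi> * (\<Sum>i\<in>- J. \<bar>x $ i\<bar>))))"
proof -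
  note part = assms(3,4) and N = assms(5)
  let ?strict = "\<forall>J x. card J \<le> s \<and> x \<in> Ker A - {0} \<and> (\<forall>i\<in>Pp - J. x $ i \<le> 0) \<longrightarrow>
          head Pp Pn J x < (\<Sum>i\<in>- J. \<bar>x $ i\<bar>)"
  let ?ratio = "\<exists>\<xi>. 0 < \<xi> \<and> \<xi> < 1 \<and>
          (\<forall>J x. card J \<le> s \<and> x \<in> Ker A \<and> (\<forall>i\<in>Pp - J. x $ i \<le> 0) \<longrightarrow>
             head Pp Pn J x \<le> \<xi> * (\<Sum>i\<in>- J. \<bar>x $ i\<bar>))"
  let ?psi = "\<exists>\<xi> \<theta>. 0 < \<xi> \<and> \<xi> < 1 \<and> 1 \<le> \<theta> \<and>
          (\<forall>x J. x \<in> Ker A \<and> card J \<le> s \<longrightarrow>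
             head Pp Pn J x \<le> \<xi> * psi_tail \<theta> Pp Pn J x)"
  let ?psi_all = "\<exists>\<xi> \<theta> \<beta>. 0 < \<xi> \<and> \<xi> < 1 \<and> 1 \<le> \<theta> \<and> 0 \<le> \<beta> \<and>
          (\<forall>x J. card J \<le> s \<longrightarrow>
             head Pp Pn J x \<le> \<beta> * N (A *v x) + \<xi> * psi_tail \<theta> Pp Pn J x)"
  let ?ratio_all = "\<exists>\<xi> \<beta>. 0 < \<xi> \<and> \<xi> < 1 \<and> 0 \<le> \<beta> \<and>
          (\<forall>J x. card J \<le> s \<and> (\<forall>i\<in>Pp - J. x $ i \<le> 0) \<longrightarrow>
             head Pp Pn J x \<le> \<beta> * N (A *v x) + \<xi> * (\<Sum>i\<in>- J. \<bar>x $ i\<bar>))"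
  have N_Ker: "N (A *v x) = 0" if "x \<in> Ker A" for x
    using that N by (simp add: Ker_def is_norm_def)
  have good: "semigood s Pp A \<longleftrightarrow> ?strict" by (rule semigood_iff[OF part])
  have strict_imp: ?psi_all if ?strict
    using that by (intro uniform_bound_of_strict[OF part N]) auto
  have psi_all_imp: ?psi if ?psi_all
  proof -
    from that obtain \<xi> \<theta> \<beta> where "0 < \<xi>" "\<xi> < 1" "1 \<le> \<theta>" and
      b: "\<And>x J. card J \<le> s \<Longrightarrow> head Pp Pn J x \<le> \<beta> * N (A *v x) + \<xi> * psi_tail \<theta> Pp Pn J x"
      by blast
    moreover have "head Pp Pn J x \<le> \<xi> * psi_tail \<theta> Pp Pn J x"
      if "x \<in> Ker A" "card J \<le> s" for x J
      using b[OF that(2), of x] N_Ker[OF that(1)] by simp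
    ultimately show ?thesis by blast
  qed
  have psi_imp: ?ratio if ?psi
    using that psi_tail_eq_l1_tail[OF part] by metis
  have psi_all_imp_ratio_all: ?ratio_all if ?psi_all
    using that psi_tail_eq_l1_tail[OF part] by metis
  have ratio_all_imp: ?ratio if ?ratio_all
  proof -
    from that obtain \<xi> \<beta> where "0 < \<xi>" "\<xi> < 1" and
      b: "\<And>J x. card J \<le> s \<Longrightarrow> \<forall>i\<in>Pp - J. x $ i \<le> 0 \<Longrightarrow>
        head Pp Pn J x \<le> \<beta> * N (A *v x) + \<xi> * (\<Sum>i\<in>- J. \<bar>x $ i\<bar>)"
      by blast
    moreover have "head Pp Pn J x \<le> \<xi> * (\<Sum>i\<in>- J. \<bar>x $ i\<bar>)"
      if "card J \<le> s" "x \<in> Ker A" "\<forall>i\<in>Pp - J. x $ i \<le> 0" for J x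
      using b[OF that(1,3)] N_Ker[OF that(2)] by simp
    ultimately show ?thesis by blast
  qed
  have ratio_imp: ?strict if ?ratio
  proof -
    from that obtain \<xi> where "\<xi> < 1" and
      b: "\<And>J x. card J \<le> s \<Longrightarrow> x \<in> Ker A \<Longrightarrow> \<forall>i\<in>Pp - J. x $ i \<le> 0 \<Longrightarrow>
        head Pp Pn J x \<le> \<xi> * (\<Sum>i\<in>- J. \<bar>x $ i\<bar>)"
      by blast
    show ?thesis
      using strict_of_ratio_bound[of Pp Pn \<xi> s A] part \<open>\<xi> < 1\<close> b by blast
  qed
  have forms: "\<forall>\<xi> \<theta>. 0 < \<xi> \<and> \<xi> < 1 \<and> 1 \<le> \<theta> \<longrightarrow>
       ((\<forall>x J. x \<in> Ker A \<and> card J \<le> s \<longrightarrow>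
           head Pp Pn J x \<le> \<xi> * psi_tail \<theta> Pp Pn J x) \<longleftrightarrow>
        (\<forall>x\<in>Ker A. Theta s \<xi> \<theta> Pp Pn x \<le> \<xi> * Psi \<theta> Pp Pn x))"
    using head_le_iff_Theta_le[OF part] by blast
  have ratio: "semigood s Pp A \<longleftrightarrow> ?ratio"
    using good strict_imp psi_all_imp psi_imp ratio_imp by argo
  have psi: "semigood s Pp A \<longleftrightarrow> ?psi"
    using good strict_imp psi_all_imp psi_imp ratio_imp by argo
  have psi_all: "semigood s Pp A \<longleftrightarrow> ?psi_all"
    using good strict_imp psi_all_imp psi_imp ratio_imp by argo
  have ratio_all: "semigood s Pp A \<longleftrightarrow> ?ratio_all"
    using ratio psi_all psi_all_imp_ratio_all ratio_all_imp by argo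
  from good ratio psi forms psi_all ratio_all show ?thesis by (intro conjI)
qed

end
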